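(* Fix $j\in\mathcal{J}$. Let $\{(z^r,t^r)\}$, $r\in\{0,\dots,R\}$, be the ordered set of vertices obtained by applying the Rider Algorithm to $\mathcal{L}_j$ with $k=p+1$ (that is, the vertices of the polygonal chain forming the $(p+1)$-upper envelope of $\mathcal{L}_j$ on $[z_j^d,z_j^u]$), and let $\{(z^{r'},t^{r'})\}$, $r'\in\{0,\dots,R'\}\subseteq\{0,\dots,R\}$, be the ordered subset of these vertices (relabelled consecutively) whose associated polygonal chain is the lower hull of $\{(z^r,t^r)\}_{r=0}^R$. Then the linear inequalities $$\frac{t^{r'+1}-t^{r'}}{z^{r'+1}-z^{r'}}\,(\hat{a}_j^{\top}x-z^{r'})+t^{r'}\le -x^{\top}a_j^{0},\qquad x\in X,\ r'\in\{0,\dots,R'-1\},$$ are valid for problem (P), i.e. they are satisfied by every feasible solution $(x,y)$ of (P).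
   Context: Data: finite index sets $\mathcal{I}$, $\mathcal{J}$ and $\mathcal{S}=\{1,\dots,|\mathcal{S}|\}$ (scenarios); a set $X\subseteq\mathbb{R}^{|\mathcal{I}|}$ (deterministic constraints); a convex function $f:\mathbb{R}^{|\mathcal{I}|}\to\mathbb{R}$; a risk parameter $\epsilon\in(0,1)$ and $p:=\lfloor\epsilon|\mathcal{S}|\rfloor$; vectors $a_j^0,\hat{a}_j\in\mathbb{R}^{|\mathcal{I}|}$ for $j\in\mathcal{J}$; real numbers $\Omega_{js},b_{js}$ for $j\in\mathcal{J},s\in\mathcal{S}$ (no sign assumptions); and constants $M_{js}$ chosen large enough that the corresponding constraint below is redundant when $y_s=1$. Problem (P): $$\min_{x,y}\ f(x)\quad\text{s.t.}\quad x\in X;\quad \Omega_{js}\hat{a}_j^{\top}x-b_{js}+x^{\top}a_j^0\le M_{js}y_s\ \ \forall j\in\mathcal{J},s\in\mathcal{S};\quad \sum_{s\in\mathcal{S}}y_s\le p;\quad y_s\in\{0,1\}\ \ \forall s\in\mathcal{S}.$$ For $j\in\mathcal{J}$ put $z_j^d=\inf_{x\in X}\hat{a}_j^{\top}x$ and $z_j^u=\sup_{x\in X}\hat{a}_j^{\top}x$, which are assumed finite. Let $L_{js}$ be the function (line) $f_{js}(z)=\Omega_{js}z-b_{js}$ for $z\in[z_j^d,z_j^u]$, and $\mathcal{L}_j=\{L_{js}:s\in\mathcal{S}\}$. The line $L_{js}$ lies above a point $(\tilde z,\tilde t)$ if $\tilde t<\Omega_{js}\tilde z-b_{js}$ and contains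 it if $\tilde t=\Omega_{js}\tilde z-b_{js}$. A point belongs to $\mathcal{L}_j$ if some line in $\mathcal{L}_j$ contains it. The upper score of a point is the number of lines of $\mathcal{L}_j$ lying above it. The $k$-upper envelope of $\mathcal{L}_j$ is the closure of the set of points that belong to $\mathcal{L}_j$ and have upper score equal to $k-1$; it is regarded as (the graph of) a piecewise linear function of $z$ on $[z_j^d,z_j^u]$. Rider Algorithm for the $k$-upper envelope of $\mathcal{L}_j$ (outputs the sequence of vertices $(z^0,t^0),\dots,(z^R,t^R)$ of the polygonal chain, $z_j^d=z^0<\dots<z^R=z_j^u$). Step 1: set $r=0$; the points $(z_j^d,\Omega_{js}z_j^d-b_{js})$, $s\in\mathcal{S}$, are assumed to have pairwise different upper scores; let $s_0$ be such that $(z_j^d,\Omega_{js_0}z_j^d-b_{js_0})$ has upper score $k-1$, and let $(z^0,t^0)$ be this point. Step 2: for the other lines compute $\mathrm{int}_z(s,s_r)=\frac{b_{js}-b_{js_r}}{\Omega_{js}-\Omega_{js_r}}$; if some $s'$ has $z^r<\mathrm{int}_z(s',s_r)<z_j^u$ go to Step 3, otherwise go to Step 4. Step 3: let $s_{r+1}=\arg\min_s\{\mathrm{int}_z(s,s_r):\mathrm{int}_z(s,s_r)>z^r\}$, set $z^{r+1}=\mathrm{int}_z(s_{r+1},s_r)$, $t^{r+1}=\Omega_{js_r}z^{r+1}-b_{js_r}$, increase $r$ by one, and return to Step 2. Step 4: set $(z^R,t^R)=(z_j^u,\Omega_{js_r}z_j^u-b_{js_r})$. The lower hull of a finite set of points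 $P\subset\mathbb{R}^2$ is the set of edges of the convex hull of $P$ that lie on or below every point of $P$. *)

theory Defs
  imports "HOL-Analysis.Analysis"
begin

text \<open>
  Scenarios are \<open>{1..n}\<close>. Constraint \<open>(j, s)\<close> is switched off by \<open>y s = 1\<close>; \<open>M\<close> holds the
  big-M constants and \<open>p\<close> the number of scenarios that may be violated.
\<close>

definition scenario_constraint ::
  "('j \<Rightarrow> nat \<Rightarrow> real) \<Rightarrow> ('j \<Rightarrow> real^'i) \<Rightarrow> ('j \<Rightarrow> real^'i) \<Rightarrow> ('j \<Rightarrow> nat \<Rightarrow> real) \<Rightarrow>
   ('j \<Rightarrow> nat \<Rightarrow> real) \<Rightarrow> real^'i \<Rightarrow> (nat \<Rightarrow> real) \<Rightarrow> 'j \<Rightarrow> nat \<Rightarrow> bool" where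
  "scenario_constraint \<Omega> ahat a0 b M x y j s \<longleftrightarrow>
     \<Omega> j s * (ahat j \<bullet> x) - b j s + x \<bullet> a0 j \<le> M j s * y s"

definition scenario_selection :: "nat \<Rightarrow> nat \<Rightarrow> (nat \<Rightarrow> real) \<Rightarrow> bool" where
  "scenario_selection n p y \<longleftrightarrow> (\<forall>s\<in>{1..n}. y s \<in> {0, 1}) \<and> (\<Sum>s\<in>{1..n}. y s) \<le> real p"

definition feasible ::
  "(real^'i) set \<Rightarrow> 'j set \<Rightarrow> nat \<Rightarrow> nat \<Rightarrow> ('j \<Rightarrow> nat \<Rightarrow> real) \<Rightarrow> ('j \<Rightarrow> real^'i) \<Rightarrow>
   ('j \<Rightarrow> real^'i) \<Rightarrow> ('j \<Rightarrow> nat \<Rightarrow> real) \<Rightarrow> ('j \<Rightarrow> nat \<Rightarrow> real) \<Rightarrow> real^'i \<Rightarrow> (nat \<Rightarrow> real) \<Rightarrow> bool"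
  where
  "feasible X J n p \<Omega> ahat a0 b M x y \<longleftrightarrow>
     x \<in> X \<and> (\<forall>j\<in>J. \<forall>s\<in>{1..n}. scenario_constraint \<Omega> ahat a0 b M x y j s) \<and>
     scenario_selection n p y"

text \<open>
  Redundancy of the constraints with \<open>y s = 1\<close>: they are implied by the remaining constraints.
  This is weaker than asking \<open>M j s\<close> to bound the left-hand side on all of \<open>X\<close>, which may be
  impossible for unbounded \<open>X\<close>.
\<close>

definition big_M ::
  "(real^'i) set \<Rightarrow> 'j set \<Rightarrow> nat \<Rightarrow> nat \<Rightarrow> ('j \<Rightarrow> nat \<Rightarrow> real) \<Rightarrow> ('j \<Rightarrow> real^'i) \<Rightarrow>
   ('j \<Rightarrow> real^'i) \<Rightarrow> ('j \<Rightarrow> nat \<Rightarrow> real) \<Rightarrow> ('j \<Rightarrow> nat \<Rightarrow> real) \<Rightarrow> bool" where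
  "big_M X J n p \<Omega> ahat a0 b M \<longleftrightarrow>
     (\<forall>x\<in>X. \<forall>y. scenario_selection n p y \<longrightarrow>
        (\<forall>j\<in>J. \<forall>s\<in>{1..n}. y s = 0 \<longrightarrow> scenario_constraint \<Omega> ahat a0 b M x y j s) \<longrightarrow>
        (\<forall>j\<in>J. \<forall>s\<in>{1..n}. y s = 1 \<longrightarrow> scenario_constraint \<Omega> ahat a0 b M x y j s))"

definition z_lo :: "(real^'i) set \<Rightarrow> real^'i \<Rightarrow> real" where
  "z_lo X a = (INF x\<in>X. a \<bullet> x)"

definition z_hi :: "(real^'i) set \<Rightarrow> real^'i \<Rightarrow> real" where
  "z_hi X a = (SUP x\<in>X. a \<bullet> x)"

text \<open>
  From here on \<open>\<Omega>\<close> and \<open>b\<close> are the slopes and offsets of the lines of one fixed row, indexed by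
  the scenarios. A line is a function on the interval between \<open>zd\<close> and \<open>zu\<close>.
\<close>

definition line_set :: "nat \<Rightarrow> (nat \<Rightarrow> real) \<Rightarrow> (nat \<Rightarrow> real) \<Rightarrow> real \<Rightarrow> real \<Rightarrow> (real \<Rightarrow> real) set" where
  "line_set n \<Omega> b zd zu = (\<lambda>s. \<lambda>z\<in>{zd..zu}. \<Omega> s * z - b s) ` {1..n}"

definition upper_score :: "(real \<Rightarrow> real) set \<Rightarrow> real \<times> real \<Rightarrow> nat" where
  "upper_score L q = card {l \<in> L. snd q < l (fst q)}"

definition upper_envelope :: "(real \<Rightarrow> real) set \<Rightarrow> real \<Rightarrow> real \<Rightarrow> nat \<Rightarrow> (real \<times> real) set" where
  "upper_envelope L zd zu k =
     closure {q. fst q \<in> {zd..zu} \<and> (\<exists>l\<in>L. snd q = l (fst q)) \<and> upper_score L q = k - 1}"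

definition polygonal_chain :: "nat \<Rightarrow> (nat \<Rightarrow> real \<times> real) \<Rightarrow> (real \<times> real) set" where
  "polygonal_chain R v = (\<Union>r<R. closed_segment (v r) (v (Suc r)))"

text \<open>The last condition says that the inner \<open>v r\<close> are genuine vertices of the chain.\<close>

definition envelope_vertices ::
  "(real \<Rightarrow> real) set \<Rightarrow> real \<Rightarrow> real \<Rightarrow> nat \<Rightarrow> nat \<Rightarrow> (nat \<Rightarrow> real) \<Rightarrow> (nat \<Rightarrow> real) \<Rightarrow> bool" where
  "envelope_vertices L zd zu k R z t \<longleftrightarrow>
     z 0 = zd \<and> z R = zu \<and> (\<forall>r<R. z r < z (Suc r)) \<and>
     polygonal_chain R (\<lambda>r. (z r, t r)) = upper_envelope L zd zu k \<and>
     (\<forall>r. Suc r < R \<longrightarrow>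
        (t (Suc r) - t r) / (z (Suc r) - z r) \<noteq>
        (t (Suc (Suc r)) - t (Suc r)) / (z (Suc (Suc r)) - z (Suc r)))"

definition int_z :: "(nat \<Rightarrow> real) \<Rightarrow> (nat \<Rightarrow> real) \<Rightarrow> nat \<Rightarrow> nat \<Rightarrow> real" where
  "int_z \<Omega> b s s' = (b s - b s') / (\<Omega> s - \<Omega> s')"

text \<open>The lines meeting line \<open>s\<close> strictly to the right of \<open>z\<close>; parallel lines never meet it.\<close>

definition crossing :: "nat \<Rightarrow> (nat \<Rightarrow> real) \<Rightarrow> (nat \<Rightarrow> real) \<Rightarrow> nat \<Rightarrow> real \<Rightarrow> nat set" where
  "crossing n \<Omega> b s z = {s' \<in> {1..n}. \<Omega> s' \<noteq> \<Omega> s \<and> z < int_z \<Omega> b s' s}"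

text \<open>
  A run of the Rider Algorithm: \<open>\<sigma> r\<close> is the line followed from the vertex \<open>(z r, t r)\<close> on, and
  Step 4 is reached with counter \<open>R - 1\<close>. The index \<open>\<sigma> (Suc r)\<close> is \<^emph>\<open>the\<close> minimiser, so a run in
  which the minimum is attained twice is not an output. With such a tie the algorithm may leave
  the envelope: if the current line is the middle one of three lines crossing in one point, it
  stays in the middle, but every minimiser is one of the outer two.
\<close>

definition rider_output ::
  "nat \<Rightarrow> (nat \<Rightarrow> real) \<Rightarrow> (nat \<Rightarrow> real) \<Rightarrow> real \<Rightarrow> real \<Rightarrow> nat \<Rightarrow>
   nat \<Rightarrow> (nat \<Rightarrow> real) \<Rightarrow> (nat \<Rightarrow> real) \<Rightarrow> bool" where
  "rider_output n \<Omega> b zd zu k R z t \<longleftrightarrow> R \<ge> 1 \<and> (\<exists>\<sigma> :: nat \<Rightarrow> nat.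
     (\<sigma> 0 \<in> {1..n} \<and> z 0 = zd \<and> t 0 = \<Omega> (\<sigma> 0) * zd - b (\<sigma> 0) \<and>
      upper_score (line_set n \<Omega> b zd zu) (z 0, t 0) = k - 1) \<and>
     (\<forall>r < R - 1.
        (\<exists>s' \<in> crossing n \<Omega> b (\<sigma> r) (z r). int_z \<Omega> b s' (\<sigma> r) < zu) \<and>
        \<sigma> (Suc r) \<in> crossing n \<Omega> b (\<sigma> r) (z r) \<and>
        (\<forall>s \<in> crossing n \<Omega> b (\<sigma> r) (z r) - {\<sigma> (Suc r)}.
           int_z \<Omega> b (\<sigma> (Suc r)) (\<sigma> r) < int_z \<Omega> b s (\<sigma> r)) \<and>
        z (Suc r) = int_z \<Omega> b (\<sigma> (Suc r)) (\<sigma> r) \<and>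
        t (Suc r) = \<Omega> (\<sigma> r) * z (Suc r) - b (\<sigma> r)) \<and>
     (\<not> (\<exists>s' \<in> crossing n \<Omega> b (\<sigma> (R - 1)) (z (R - 1)). int_z \<Omega> b s' (\<sigma> (R - 1)) < zu) \<and>
      z R = zu \<and> t R = \<Omega> (\<sigma> (R - 1)) * zu - b (\<sigma> (R - 1))))"

text \<open>
  An edge lies on or below a point if the line it spans does; comparing only over the abscissae
  of the edge itself would also admit edges of the upper hull.
\<close>

definition lower_hull :: "(real \<times> real) set \<Rightarrow> (real \<times> real) set set" where
  "lower_hull P =
     {e. e edge_of (convex hull P) \<and> (\<forall>(u, v)\<in>P. \<forall>w. (u, w) \<in> affine hull e \<longrightarrow> w \<le> v)}"

end

theory Submission
  imports Defs
begin

text \<open>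
  A feasible point violates at most \<open>p\<close> scenarios, so of any \<open>p + 1\<close> lines at least one belongs to
  a satisfied constraint. Every point of the \<open>(p + 1)\<close>-upper envelope has at least \<open>p + 1\<close> lines on
  or above it, hence \<open>- (x \<bullet> a0 j)\<close> is at least the height of the envelope above \<open>ahat j \<bullet> x\<close>.
  The line spanned by an edge of the lower hull lies below all vertices of the chain and so, by
  interpolation, below the chain itself.
\<close>

text \<open>Scenario indices are collected instead of line functions, so coinciding lines count with
  multiplicity, as their constraints do. The non-strict comparison includes a line through
  \<open>q\<close> and turns a lower bound on the count into a closed condition.\<close>

definition lines_above :: "nat \<Rightarrow> (nat \<Rightarrow> real) \<Rightarrow> (nat \<Rightarrow> real) \<Rightarrow> real \<times> real \<Rightarrow> nat set" where
  "lines_above n \<Omega> b q = {s \<in> {1..n}. snd q \<le> \<Omega> s * fst q - b s}"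

lemma finite_lines_above [simp]: "finite (lines_above n \<Omega> b q)"
  by (simp add: lines_above_def)

section \<open>Lower hull edges and polygonal chains\<close>

lemma finite_lower_hull: "finite P \<Longrightarrow> finite (lower_hull P)"
  by (rule finite_subset[OF _ finite_polytope_faces[OF polytope_convex_hull]])
    (auto simp: lower_hull_def edge_of_def)

text \<open>
  The segment need not be an edge itself, but it shares infinitely many points with one of the
  finitely many edges, and two of them already determine the line.
\<close>

lemma line_below_lower_hull:
  assumes P: "finite P" "(u, v) \<in> P"
    and sub: "closed_segment a c \<subseteq> \<Union> (lower_hull P)"
    and ne: "fst a \<noteq> fst c"
  shows "(snd c - snd a) / (fst c - fst a) * (u - fst a) + snd a \<le> v"
proof -
  have "infinite (closed_segment a c)"
    using ne by auto
  moreover have "closed_segment a c \<subseteq> (\<Union>e\<in>lower_hull P. closed_segment a c \<inter> e)"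
    using sub by blast
  ultimately obtain e where e: "e \<in> lower_hull P" and inf: "infinite (closed_segment a c \<inter> e)"
    using finite_lower_hull[OF P(1)] by (meson finite_UN_I finite_subset)
  obtain d where d: "d \<in> closed_segment a c \<inter> e"
    using inf by (metis ex_in_conv finite.emptyI)
  obtain d' where d': "d' \<in> closed_segment a c \<inter> e" "d' \<noteq> d"
    using inf by (metis finite.simps insertI1 finite_subset subset_singleton_iff subsetI insert_iff)
  obtain m where m: "d = (1 - m) *\<^sub>R a + m *\<^sub>R c"
    using d by (auto simp: in_segment)
  obtain m' where m': "d' = (1 - m') *\<^sub>R a + m' *\<^sub>R c"
    using d' by (auto simp: in_segment)
  have mm: "m' - m \<noteq> 0"
    using m m' d'(2) by auto
  \<comment> \<open>\<open>l\<close> is the parameter, along the line through \<open>a\<close> and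
    \<open>c\<close>, of the point with abscissa \<open>u\<close>; \<open>k\<close> is the parameter
    of the same point with respect to \<open>d\<close> and \<open>d'\<close>. Since \<open>d\<close>
    and \<open>d'\<close> lie in \<open>e\<close>, that point lies in
    \<open>affine hull e\<close>.\<close>
  define l where "l = (u - fst a) / (fst c - fst a)"
  define k where "k = (l - m) / (m' - m)"
  have "(1 - k) *\<^sub>R d + k *\<^sub>R d' \<in> affine hull e"
    using d d' by (intro mem_affine) (auto simp: hull_inc)
  moreover have "(1 - k) *\<^sub>R d + k *\<^sub>R d' = (1 - (m + k * (m' - m))) *\<^sub>R a + (m + k * (m' - m)) *\<^sub>R c"
    by (simp add: m m' prod_eq_iff algebra_simps)
  moreover have "m + k * (m' - m) = l"
    using mm by (simp add: k_def)
  ultimately have "(1 - l) *\<^sub>R a + l *\<^sub>R c \<in> affine hull e"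
    by simp
  moreover have "fst ((1 - l) *\<^sub>R a + l *\<^sub>R c) = u"
  proof -
    have "l * (fst c - fst a) = u - fst a"
      using ne by (simp add: l_def)
    then show ?thesis
      by (simp add: algebra_simps)
  qed
  ultimately have "snd ((1 - l) *\<^sub>R a + l *\<^sub>R c) \<le> v"
    using e P(2) unfolding lower_hull_def by (smt (verit) case_prodD mem_Collect_eq prod.collapse)
  then show ?thesis
    by (simp add: l_def algebra_simps diff_divide_distrib)
qed

text \<open>A discrete intermediate value argument: if \<open>w\<close> is already reached by an
  earlier positive index, induction applies; otherwise the last step brackets it.\<close>

lemma exists_bracketing_index:
  fixes z :: "nat \<Rightarrow> 'a::linorder"
  assumes "z 0 \<le> w" "w \<le> z R" "R > 0"
  shows "\<exists>r<R. z r \<le> w \<and> w \<le> z (Suc r)"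
  using assms
proof (induction R)
  case (Suc R)
  show ?case
  proof (cases "R > 0 \<and> w \<le> z R")
    case True
    then show ?thesis
      using Suc by (meson less_SucI)
  next
    case False
    then show ?thesis
      using Suc.prems by (intro exI[of _ R]) auto
  qed
qed simp

text \<open>Over the segment that covers \<open>w\<close>, both the affine function and the chain
  interpolate linearly between the end points, so the inequality at the two vertices carries over
  with the same weights.\<close>

lemma affine_below_polygonal_chain:
  fixes z t :: "nat \<Rightarrow> real"
  assumes "z 0 \<le> w" "w \<le> z R" "R > 0"
    and below: "\<And>r. r \<le> R \<Longrightarrow> m * (z r - z0) + t0 \<le> t r"
  obtains v where "(w, v) \<in> polygonal_chain R (\<lambda>r. (z r, t r))" "m * (w - z0) + t0 \<le> v"
proof -
  obtain r where r: "r < R" "z r \<le> w" "w \<le> z (Suc r)"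
    using exists_bracketing_index[OF assms(1-3)] by blast
  then have "w \<in> closed_segment (z r) (z (Suc r))"
    by (simp add: closed_segment_eq_real_ivl)
  then obtain l where l: "0 \<le> l" "l \<le> 1" "w = (1 - l) * z r + l * z (Suc r)"
    by (auto simp: in_segment)
  define v where "v = (1 - l) * t r + l * t (Suc r)"
  have "(w, v) = (1 - l) *\<^sub>R (z r, t r) + l *\<^sub>R (z (Suc r), t (Suc r))"
    by (simp add: l v_def)
  then have "(w, v) \<in> closed_segment (z r, t r) (z (Suc r), t (Suc r))"
    using l unfolding in_segment by blast
  moreover have "(1 - l) * (m * (z r - z0) + t0) + l * (m * (z (Suc r) - z0) + t0) \<le> v"
    unfolding v_def using below r l by (intro add_mono mult_left_mono) auto
  then have "m * (w - z0) + t0 \<le> v"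
    by (simp add: l algebra_simps)
  ultimately show ?thesis
    using that r by (auto simp: polygonal_chain_def)
qed

section \<open>Counting lines above the upper envelope\<close>

text \<open>The lines above the point form an image of the index set on the right. Equality may fail
  because several scenarios can define the same line.\<close>

lemma upper_score_line_set_le:
  assumes "w \<in> {zd..zu}"
  shows "upper_score (line_set n \<Omega> b zd zu) (w, v) \<le> card {s \<in> {1..n}. v < \<Omega> s * w - b s}"
proof -
  have "{l \<in> line_set n \<Omega> b zd zu. v < l w} \<subseteq>
      (\<lambda>s. \<lambda>z\<in>{zd..zu}. \<Omega> s * z - b s) ` {s \<in> {1..n}. v < \<Omega> s * w - b s}"
    using assms by (auto simp: line_set_def)
  then show ?thesis
    unfolding upper_score_def by (simp add: surj_card_le)
qed

text \<open>The set is a finite union, over the index sets \<open>S\<close> with at least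
  \<open>m\<close> elements, of intersections of closed half-planes. Closedness is what lets the
  count pass to the closure in \<open>upper_envelope\<close>.\<close>

lemma closed_lines_above: "closed {q. m \<le> card (lines_above n \<Omega> b q)}"
proof -
  have "{q. m \<le> card (lines_above n \<Omega> b q)} =
      (\<Union>S\<in>{S. S \<subseteq> {1..n} \<and> m \<le> card S}. \<Inter>s\<in>S. {q. snd q \<le> \<Omega> s * fst q - b s})"
  proof (intro equalityI subsetI)
    fix q assume "q \<in> {q. m \<le> card (lines_above n \<Omega> b q)}"
    then show "q \<in> (\<Union>S\<in>{S. S \<subseteq> {1..n} \<and> m \<le> card S}. \<Inter>s\<in>S. {q. snd q \<le> \<Omega> s * fst q - b s})"
      by (intro UN_I[of "lines_above n \<Omega> b q"]) (auto simp: lines_above_def)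
  next
    fix q assume "q \<in> (\<Union>S\<in>{S. S \<subseteq> {1..n} \<and> m \<le> card S}. \<Inter>s\<in>S. {q. snd q \<le> \<Omega> s * fst q - b s})"
    then obtain S where S: "S \<subseteq> {1..n}" "m \<le> card S" "\<forall>s\<in>S. snd q \<le> \<Omega> s * fst q - b s"
      by blast
    then have "S \<subseteq> lines_above n \<Omega> b q"
      unfolding lines_above_def by blast
    then have "card S \<le> card (lines_above n \<Omega> b q)"
      by (simp add: card_mono)
    then show "q \<in> {q. m \<le> card (lines_above n \<Omega> b q)}"
      using S by simp
  qed
  moreover have "closed {q :: real \<times> real. snd q \<le> \<Omega> s * fst q - b s}" for s
    by (intro closed_Collect_le continuous_intros)
  ultimately show ?thesis
    by (simp add: closed_UN closed_INT)
qed

lemma upper_envelope_lines_above: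
  "upper_envelope (line_set n \<Omega> b zd zu) zd zu (p + 1) \<subseteq> {q. p + 1 \<le> card (lines_above n \<Omega> b q)}"
  unfolding upper_envelope_def
proof (rule closure_minimal[OF _ closed_lines_above], rule subsetI)
  fix q
  assume "q \<in> {q. fst q \<in> {zd..zu} \<and> (\<exists>l\<in>line_set n \<Omega> b zd zu. snd q = l (fst q)) \<and>
    upper_score (line_set n \<Omega> b zd zu) q = p + 1 - 1}"
  then obtain w l where w: "zd \<le> w" "w \<le> zu" and l: "l \<in> line_set n \<Omega> b zd zu"
    and score: "upper_score (line_set n \<Omega> b zd zu) (w, l w) = p" and q: "q = (w, l w)"
    by (cases q) auto
  obtain i where i: "i \<in> {1..n}" "l w = \<Omega> i * w - b i"
    using l w by (auto simp: line_set_def)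
  \<comment> \<open>The \<open>p\<close> lines strictly above the point are joined by line
    \<open>i\<close>, which passes through it and hence is not among them.\<close>
  have "Suc p \<le> card (insert i {s \<in> {1..n}. l w < \<Omega> s * w - b s})"
    using upper_score_line_set_le[of w zd zu n \<Omega> b "l w"] w score i by simp
  also have "\<dots> \<le> card (lines_above n \<Omega> b (w, l w))"
    using i by (intro card_mono) (auto simp: lines_above_def)
  finally show "q \<in> {q. p + 1 \<le> card (lines_above n \<Omega> b q)}"
    by (simp add: q)
qed

section \<open>Runs of the Rider Algorithm\<close>

text \<open>Breaking ties at \<open>z\<close> by slope compares the lines immediately to the right of \<open>z\<close>.\<close>

definition right_above :: "nat \<Rightarrow> (nat \<Rightarrow> real) \<Rightarrow> (nat \<Rightarrow> real) \<Rightarrow> nat \<Rightarrow> real \<Rightarrow> nat set" where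
  "right_above n \<Omega> b i z = {s \<in> {1..n}. \<Omega> i * z - b i < \<Omega> s * z - b s \<or>
     \<Omega> i * z - b i = \<Omega> s * z - b s \<and> \<Omega> i < \<Omega> s}"

lemma finite_right_above [simp]: "finite (right_above n \<Omega> b i z)"
  by (simp add: right_above_def)

lemma int_z_eq_iff:
  assumes "\<Omega> s \<noteq> \<Omega> i"
  shows "int_z \<Omega> b s i = z \<longleftrightarrow> \<Omega> s * z - b s = \<Omega> i * z - b i"
  using assms by (auto simp: int_z_def field_simps)

text \<open>A line that starts above line \<open>i\<close> just right of \<open>z\<close> and is
  below it at \<open>w\<close> must cross it strictly between \<open>z\<close> and \<open>w\<close>,
  before the first admissible crossing.\<close>

lemma right_above_until_crossing:
  assumes s: "s \<in> right_above n \<Omega> b i z" and "z \<le> w"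
    and cross: "\<And>s'. s' \<in> crossing n \<Omega> b i z \<Longrightarrow> w \<le> int_z \<Omega> b s' i"
  shows "\<Omega> i * w - b i \<le> \<Omega> s * w - b s"
proof (rule ccontr)
  assume "\<not> \<Omega> i * w - b i \<le> \<Omega> s * w - b s"
  then have less: "\<Omega> s * w - b s < \<Omega> i * w - b i"
    by simp
  have ge: "\<Omega> i * z - b i \<le> \<Omega> s * z - b s" "s \<in> {1..n}"
    using s by (auto simp: right_above_def)
  have "(\<Omega> i - \<Omega> s) * (w - z) > 0"
    using less ge by (simp add: algebra_simps)
  then have slope: "\<Omega> s < \<Omega> i"
    using \<open>z \<le> w\<close> by (simp add: zero_less_mult_iff)
  then have strict: "\<Omega> i * z - b i < \<Omega> s * z - b s"
    using s by (auto simp: right_above_def)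
  have eq: "int_z \<Omega> b s i = (b i - b s) / (\<Omega> i - \<Omega> s)"
    unfolding int_z_def by (metis minus_diff_eq minus_divide_divide)
  have "z < int_z \<Omega> b s i" "int_z \<Omega> b s i < w"
    using strict less slope by (simp_all add: eq field_simps)
  then show False
    using cross[of s] ge slope by (force simp: crossing_def)
qed

text \<open>
  As only the lines \<open>i\<close> and \<open>i'\<close> pass through the crossing point, all others keep their position,
  and these two change places.
\<close>

lemma card_right_above_crossing:
  assumes i: "i \<in> {1..n}" and i': "i' \<in> crossing n \<Omega> b i z"
    and min: "\<And>s. s \<in> crossing n \<Omega> b i z - {i'} \<Longrightarrow> int_z \<Omega> b i' i < int_z \<Omega> b s i"
    and distinct: "\<And>s. s \<in> {1..n} \<Longrightarrow> \<Omega> s = \<Omega> i \<Longrightarrow> b s = b i \<Longrightarrow> s = i"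
  shows "card (right_above n \<Omega> b i z) \<le> card (right_above n \<Omega> b i' (int_z \<Omega> b i' i))"
proof -
  let ?w = "int_z \<Omega> b i' i" and ?A = "right_above n \<Omega> b i z"
  let ?B = "right_above n \<Omega> b i' ?w"
  have zw: "z < ?w" and slope: "\<Omega> i' \<noteq> \<Omega> i"
    using i' by (auto simp: crossing_def)
  have meet: "\<Omega> i' * ?w - b i' = \<Omega> i * ?w - b i"
    using int_z_eq_iff[of \<Omega> i' i b ?w] slope by simp
  have ge: "\<Omega> i * ?w - b i \<le> \<Omega> s * ?w - b s" if "s \<in> ?A" for s
    using that zw min by (intro right_above_until_crossing) force+
  have keep: "?A - {i'} \<subseteq> ?B"
  proof
    fix s assume s: "s \<in> ?A - {i'}"
    then have sn: "s \<in> {1..n}" "s \<noteq> i"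
      by (auto simp: right_above_def)
    \<comment> \<open>A further line through the crossing point would either coincide with line
      \<open>i\<close>, against \<open>distinct\<close>, or tie with \<open>i'\<close> for the
      minimum, against \<open>min\<close>.\<close>
    have "\<Omega> i * ?w - b i \<noteq> \<Omega> s * ?w - b s"
    proof
      assume eq: "\<Omega> i * ?w - b i = \<Omega> s * ?w - b s"
      show False
      proof (cases "\<Omega> s = \<Omega> i")
        case True
        then show False
          using eq distinct sn by auto
      next
        case False
        then have "int_z \<Omega> b s i = ?w"
          using eq by (simp add: int_z_eq_iff)
        then show False
          using min[of s] s sn False zw by (auto simp: crossing_def)
      qed
    qed
    then show "s \<in> ?B"
      using ge[of s] s sn meet by (auto simp: right_above_def)
  qed
  show ?thesis
  proof (cases "i' \<in> ?A")
    case False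
    then show ?thesis
      using keep by (intro card_mono) auto
  next
    case True
    \<comment> \<open>Line \<open>i'\<close> is strictly above line \<open>i\<close> at
      \<open>z\<close> and meets it at \<open>?w\<close>, so it has the smaller slope. To the right
      of \<open>?w\<close> line \<open>i\<close> is therefore above \<open>i'\<close> and replaces
      it in the count.\<close>
    have "\<Omega> i * z - b i \<noteq> \<Omega> i' * z - b i'"
      using zw int_z_eq_iff[OF slope, of b z] by auto
    then have "\<Omega> i * z - b i < \<Omega> i' * z - b i'"
      using True by (auto simp: right_above_def)
    then have "(\<Omega> i - \<Omega> i') * (?w - z) > 0"
      using meet by (simp add: algebra_simps)
    then have "\<Omega> i' < \<Omega> i"
      using zw by (simp add: zero_less_mult_iff)
    then have "insert i (?A - {i'}) \<subseteq> ?B"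
      using keep i meet by (auto simp: right_above_def)
    moreover have "card (insert i (?A - {i'})) = card ?A"
    proof -
      have "i \<notin> ?A"
        by (simp add: right_above_def)
      then show ?thesis
        using card_Suc_Diff1[OF finite_right_above True] by simp
    qed
    ultimately show ?thesis
      by (metis card_mono finite_right_above)
  qed
qed

text \<open>Inner steps increase by the definition of \<open>crossing\<close>. The last step needs
  the vertex before it to stay left of \<open>zu\<close>: the minimal crossing is no later than the
  one before \<open>zu\<close> that sends the algorithm to Step 3.\<close>

lemma rider_output_increasing:
  assumes "rider_output n \<Omega> b zd zu k R z t" "zd < zu"
  shows "z 0 = zd" "z R = zu" "R > 0" "\<And>r. r < R \<Longrightarrow> z r < z (Suc r)"
proof -
  obtain \<sigma> where R: "R \<ge> 1" and 0: "z 0 = zd"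
    and step: "\<And>r. r < R - 1 \<Longrightarrow> (\<exists>s' \<in> crossing n \<Omega> b (\<sigma> r) (z r). int_z \<Omega> b s' (\<sigma> r) < zu) \<and>
        \<sigma> (Suc r) \<in> crossing n \<Omega> b (\<sigma> r) (z r) \<and>
        (\<forall>s \<in> crossing n \<Omega> b (\<sigma> r) (z r) - {\<sigma> (Suc r)}.
           int_z \<Omega> b (\<sigma> (Suc r)) (\<sigma> r) < int_z \<Omega> b s (\<sigma> r)) \<and>
        z (Suc r) = int_z \<Omega> b (\<sigma> (Suc r)) (\<sigma> r)"
    and last: "z R = zu"
    using assms(1) unfolding rider_output_def by blast
  show "z 0 = zd" "z R = zu" "R > 0"
    using R 0 last by auto
  have less_zu: "z r < zu" if "r \<le> R - 1" for r
  proof (cases r)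
    case (Suc q)
    then have "q < R - 1"
      using that by simp
    from step[OF this] show ?thesis
      unfolding Suc by (metis DiffI less_trans singletonD)
  qed (use 0 assms in auto)
  fix r assume r: "r < R"
  show "z r < z (Suc r)"
  proof (cases "r < R - 1")
    case True
    then show ?thesis
      using step[OF True] by (auto simp: crossing_def)
  next
    case False
    then have "Suc r = R"
      using r by simp
    then show ?thesis
      using less_zu[of r] last by simp
  qed
qed

text \<open>At every vertex at least \<open>p\<close> scenarios lie above the followed line
  immediately to the right. They stay on or above it until the next vertex, and the followed line
  itself is the one extra scenario.\<close>

lemma rider_output_lines_above:
  assumes rider: "rider_output n \<Omega> b zd zu (p + 1) R z t" and "zd < zu"
    and inj: "inj_on (\<lambda>s. upper_score (line_set n \<Omega> b zd zu) (zd, \<Omega> s * zd - b s)) {1..n}"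
  shows "polygonal_chain R (\<lambda>r. (z r, t r)) \<subseteq> {q. p + 1 \<le> card (lines_above n \<Omega> b q)}"
proof -
  obtain \<sigma> where R: "R \<ge> 1"
    and start: "\<sigma> 0 \<in> {1..n}" "z 0 = zd" "t 0 = \<Omega> (\<sigma> 0) * zd - b (\<sigma> 0)"
      "upper_score (line_set n \<Omega> b zd zu) (z 0, t 0) = p"
    and step: "\<And>r. r < R - 1 \<Longrightarrow>
        \<sigma> (Suc r) \<in> crossing n \<Omega> b (\<sigma> r) (z r) \<and>
        (\<forall>s \<in> crossing n \<Omega> b (\<sigma> r) (z r) - {\<sigma> (Suc r)}.
           int_z \<Omega> b (\<sigma> (Suc r)) (\<sigma> r) < int_z \<Omega> b s (\<sigma> r)) \<and>
        z (Suc r) = int_z \<Omega> b (\<sigma> (Suc r)) (\<sigma> r) \<and>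
        t (Suc r) = \<Omega> (\<sigma> r) * z (Suc r) - b (\<sigma> r)"
    and no_crossing: "\<not> (\<exists>s' \<in> crossing n \<Omega> b (\<sigma> (R - 1)) (z (R - 1)). int_z \<Omega> b s' (\<sigma> (R - 1)) < zu)"
    and last: "z R = zu" "t R = \<Omega> (\<sigma> (R - 1)) * zu - b (\<sigma> (R - 1))"
    using rider unfolding rider_output_def add_diff_cancel_right' by blast
  \<comment> \<open>Coinciding lines would have equal upper scores at \<open>zd\<close>.\<close>
  have distinct: "s = i" if "s \<in> {1..n}" "i \<in> {1..n}" "\<Omega> s = \<Omega> i" "b s = b i" for s i
    using inj_onD[OF inj, of s i] that by simp
  have invariant: "\<sigma> r \<in> {1..n} \<and> t r = \<Omega> (\<sigma> r) * z r - b (\<sigma> r) \<and>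
      p \<le> card (right_above n \<Omega> b (\<sigma> r) (z r))" if "r < R" for r
    using that
  proof (induction r)
    case 0
    have "p \<le> card {s \<in> {1..n}. t 0 < \<Omega> s * zd - b s}"
      using upper_score_line_set_le[of zd zd zu n \<Omega> b "t 0"] start \<open>zd < zu\<close> by simp
    also have "\<dots> \<le> card (right_above n \<Omega> b (\<sigma> 0) (z 0))"
      using start by (intro card_mono) (auto simp: right_above_def)
    finally show ?case
      using start by simp
  next
    case (Suc r)
    then have r: "r < R - 1"
      by simp
    note st = step[OF r]
    have cr: "\<sigma> (Suc r) \<in> {1..n}" "\<Omega> (\<sigma> (Suc r)) \<noteq> \<Omega> (\<sigma> r)"
      using st by (auto simp: crossing_def)
    have "t (Suc r) = \<Omega> (\<sigma> (Suc r)) * z (Suc r) - b (\<sigma> (Suc r))"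
      using st cr int_z_eq_iff[of \<Omega> "\<sigma> (Suc r)" "\<sigma> r" b "z (Suc r)"] by simp
    moreover have "card (right_above n \<Omega> b (\<sigma> r) (z r)) \<le>
        card (right_above n \<Omega> b (\<sigma> (Suc r)) (z (Suc r)))"
      using st Suc distinct card_right_above_crossing[of "\<sigma> r" n "\<sigma> (Suc r)" \<Omega> b "z r"] by simp
    ultimately show ?case
      using Suc cr by simp
  qed
  show ?thesis
    unfolding polygonal_chain_def
  proof (intro UN_least subsetI CollectI)
    fix r q
    assume "r \<in> {..<R}" and q: "q \<in> closed_segment (z r, t r) (z (Suc r), t (Suc r))"
    then have r: "r < R"
      by simp
    let ?i = "\<sigma> r"
    have zz: "z r < z (Suc r)"
      using rider_output_increasing(4)[OF rider \<open>zd < zu\<close> r] .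
    \<comment> \<open>On an inner edge the next vertex is the first crossing; on the last edge it is
      \<open>zu\<close>, and Step 4 is reached only if no crossing precedes
      \<open>zu\<close>.\<close>
    have cross: "z (Suc r) \<le> int_z \<Omega> b s ?i" if "s \<in> crossing n \<Omega> b ?i (z r)" for s
    proof (cases "r < R - 1")
      case True
      then show ?thesis
        using step[OF True] that by (cases "s = \<sigma> (Suc r)") (simp_all add: less_imp_le)
    next
      case False
      then have "r = R - 1" "Suc r = R"
        using r by auto
      then show ?thesis
        using last no_crossing that by (auto simp: not_less)
    qed
    have t_Suc: "t (Suc r) = \<Omega> ?i * z (Suc r) - b ?i"
    proof (cases "r < R - 1")
      case True
      then show ?thesis
        using step[OF True] by simp
    next
      case False
      then have "r = R - 1" "Suc r = R"
        using r by auto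
      then show ?thesis
        using last by simp
    qed
    obtain l where l: "0 \<le> l" "l \<le> 1"
      "q = (1 - l) *\<^sub>R (z r, t r) + l *\<^sub>R (z (Suc r), t (Suc r))"
      using q by (auto simp: in_segment)
    have "snd q = (1 - l) * (\<Omega> ?i * z r - b ?i) + l * (\<Omega> ?i * z (Suc r) - b ?i)"
      using invariant[OF r] t_Suc l by simp
    then have on: "snd q = \<Omega> ?i * fst q - b ?i"
      using l by (simp add: algebra_simps)
    have "fst q \<in> closed_segment (z r) (z (Suc r))"
      using l by (auto simp: in_segment)
    then have q_range: "z r \<le> fst q" "fst q \<le> z (Suc r)"
      using zz by (auto simp: closed_segment_eq_real_ivl)
    have "insert ?i (right_above n \<Omega> b ?i (z r)) \<subseteq> lines_above n \<Omega> b q"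
    proof
      fix s assume s: "s \<in> insert ?i (right_above n \<Omega> b ?i (z r))"
      have "\<Omega> ?i * fst q - b ?i \<le> \<Omega> s * fst q - b s"
      proof (cases "s = ?i")
        case False
        then show ?thesis
          using s q_range cross by (intro right_above_until_crossing) force+
      qed simp
      then show "s \<in> lines_above n \<Omega> b q"
        using s invariant[OF r] on by (auto simp: lines_above_def right_above_def)
    qed
    then have "card (insert ?i (right_above n \<Omega> b ?i (z r))) \<le> card (lines_above n \<Omega> b q)"
      by (intro card_mono) auto
    then show "p + 1 \<le> card (lines_above n \<Omega> b q)"
      using invariant[OF r] by (simp add: right_above_def)
  qed
qed

section \<open>Feasible points and validity of the inequalities\<close>

text \<open>If all of these scenarios had \<open>y s = 1\<close>, the sum of \<open>y\<close> would
  exceed \<open>p\<close>. One with \<open>y s = 0\<close> loses its big-M term, and its constraint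
  bounds the height of its line, hence \<open>v\<close>.\<close>

lemma feasible_above_point:
  assumes feas: "feasible X J n p \<Omega> ahat a0 b M x y" and "j \<in> J"
    and card: "p + 1 \<le> card (lines_above n (\<Omega> j) (b j) (ahat j \<bullet> x, v))"
  shows "v \<le> - (x \<bullet> a0 j)"
proof -
  have y: "\<And>s. s \<in> {1..n} \<Longrightarrow> y s \<in> {0, 1}" and sum: "(\<Sum>s\<in>{1..n}. y s) \<le> real p"
    using feas by (auto simp: feasible_def scenario_selection_def)
  let ?A = "lines_above n (\<Omega> j) (b j) (ahat j \<bullet> x, v)"
  have sub: "?A \<subseteq> {1..n}"
    by (auto simp: lines_above_def)
  have "\<exists>s\<in>?A. y s = 0"
  proof (rule ccontr)
    assume "\<not> (\<exists>s\<in>?A. y s = 0)"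
    then have "\<And>s. s \<in> ?A \<Longrightarrow> y s = 1"
      using y sub by blast
    then have "real (card ?A) = (\<Sum>s\<in>?A. y s)"
      by simp
    also have "\<dots> \<le> (\<Sum>s\<in>{1..n}. y s)"
      using y sub by (intro sum_mono2) force+
    finally show False
      using sum card by simp
  qed
  then obtain s where s: "s \<in> ?A" "y s = 0"
    by blast
  then have "scenario_constraint \<Omega> ahat a0 b M x y j s"
    using feas \<open>j \<in> J\<close> sub by (auto simp: feasible_def)
  then show ?thesis
    using s by (simp add: scenario_constraint_def lines_above_def)
qed

theorem corollary2p5:
  fixes X :: "(real^'i) set"
    and f :: "real^'i \<Rightarrow> real"
    and J :: "'j set"
    and n p :: nat
    and \<epsilon> :: real
    and ahat a0 :: "'j \<Rightarrow> real^'i"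
    and \<Omega> b M :: "'j \<Rightarrow> nat \<Rightarrow> real"
    and j :: 'j
    and zd zu :: real
    and R R' :: nat
    and z t :: "nat \<Rightarrow> real"
    and \<rho> :: "nat \<Rightarrow> nat"
  assumes "finite J"
    and "convex_on UNIV f"
    and "0 < \<epsilon>" "\<epsilon> < 1"
    and "p = nat \<lfloor>\<epsilon> * real n\<rfloor>"
    and "big_M X J n p \<Omega> ahat a0 b M"
    and "X \<noteq> {}"
    and "\<And>i. i \<in> J \<Longrightarrow> bdd_below ((\<lambda>x. ahat i \<bullet> x) ` X)"
    and "\<And>i. i \<in> J \<Longrightarrow> bdd_above ((\<lambda>x. ahat i \<bullet> x) ` X)"
    and "j \<in> J"
    and "zd = z_lo X (ahat j)" "zu = z_hi X (ahat j)"
    and "inj_on (\<lambda>s. upper_score (line_set n (\<Omega> j) (b j) zd zu) (zd, \<Omega> j s * zd - b j s)) {1..n}"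
    and "rider_output n (\<Omega> j) (b j) zd zu (p + 1) R z t \<or>
         envelope_vertices (line_set n (\<Omega> j) (b j) zd zu) zd zu (p + 1) R z t"
    and "strict_mono_on {0..R'} \<rho>" "\<rho> ` {0..R'} \<subseteq> {0..R}"
    and "polygonal_chain R' (\<lambda>r'. (z (\<rho> r'), t (\<rho> r'))) = \<Union> (lower_hull ((\<lambda>r. (z r, t r)) ` {0..R}))"
  shows "\<forall>x y. feasible X J n p \<Omega> ahat a0 b M x y \<longrightarrow>
           (\<forall>r'<R'. (t (\<rho> (Suc r')) - t (\<rho> r')) / (z (\<rho> (Suc r')) - z (\<rho> r')) *
                      (ahat j \<bullet> x - z (\<rho> r')) + t (\<rho> r') \<le> - (x \<bullet> a0 j))"
proof (intro allI impI)
  fix x y r'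
  assume feas: "feasible X J n p \<Omega> ahat a0 b M x y" and r': "r' < R'"
  let ?v = "\<lambda>r. (z r, t r)" and ?i = "\<rho> r'" and ?k = "\<rho> (Suc r')"
  let ?P = "?v ` {0..R}"
  have ik: "?i < ?k" "?i \<le> R" "?k \<le> R"
    using assms(15,16) r' by (auto simp: strict_mono_on_def image_subset_iff)
  have x: "x \<in> X"
    using feas by (simp add: feasible_def)
  have w: "zd \<le> ahat j \<bullet> x" "ahat j \<bullet> x \<le> zu"
    using x assms(8,9)[OF assms(10)] unfolding assms(11,12) z_lo_def z_hi_def
    by (auto intro: cINF_lower cSUP_upper)
  have seg: "closed_segment (?v ?i) (?v ?k) \<subseteq> \<Union> (lower_hull ?P)"
    using r' unfolding assms(17)[symmetric] polygonal_chain_def by blast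
  \<comment> \<open>Both descriptions of the vertices enter the argument only through these
    facts.\<close>
  have chain: "z 0 = zd \<and> z R = zu \<and> (\<forall>r<R. z r < z (Suc r)) \<and>
      polygonal_chain R ?v \<subseteq> {q. p + 1 \<le> card (lines_above n (\<Omega> j) (b j) q)}"
    using assms(14)
  proof
    assume rider: "rider_output n (\<Omega> j) (b j) zd zu (p + 1) R z t"
    \<comment> \<open>If \<open>zd = zu\<close>, no crossing fits strictly between them, so the run
      has a single, degenerate step and both vertices coincide. The hull is then a point without
      edges, although it should contain the segment \<open>seg\<close>.\<close>
    have "zd < zu"
    proof (rule ccontr)
      assume "\<not> zd < zu"
      then have "zd = zu"
        using w by simp
      obtain \<sigma> where rid: "R \<ge> 1" "z 0 = zd" "t 0 = \<Omega> j (\<sigma> 0) * zd - b j (\<sigma> 0)"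
        "0 < R - 1 \<Longrightarrow> \<exists>s' \<in> crossing n (\<Omega> j) (b j) (\<sigma> 0) (z 0). int_z (\<Omega> j) (b j) s' (\<sigma> 0) < zu"
        "z R = zu" "t R = \<Omega> j (\<sigma> (R - 1)) * zu - b j (\<sigma> (R - 1))"
        using rider unfolding rider_output_def by blast
      then have "\<not> 0 < R - 1"
        using \<open>zd = zu\<close> by (force simp: crossing_def)
      then have R: "R = 1"
        using rid(1) by simp
      then have "?v 1 = ?v 0"
        using rid \<open>zd = zu\<close> by simp
      moreover have "{0..R} = {0, 1}"
        using R by auto
      ultimately have P: "?P = {?v 0}"
        by simp
      have "lower_hull ?P = {}"
        unfolding P lower_hull_def edge_of_def
        by (auto dest!: face_of_imp_subset simp: subset_singleton_iff)
      then show False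
        using seg by simp
    qed
    then show ?thesis
      using rider_output_increasing[OF rider] rider_output_lines_above[OF rider _ assms(13)] by blast
  next
    assume "envelope_vertices (line_set n (\<Omega> j) (b j) zd zu) zd zu (p + 1) R z t"
    then show ?thesis
      using upper_envelope_lines_above unfolding envelope_vertices_def by metis
  qed
  \<comment> \<open>Strictly increasing abscissae make the selected segment non-vertical, so that
    its slope is meaningful.\<close>
  have "z ?i < z k" if "?i < k" "k \<le> R" for k
    using that
  proof (induction k)
    case (Suc k)
    then show ?case
      using chain by (cases "?i = k") (auto intro: less_trans)
  qed simp
  then have "fst (?v ?i) \<noteq> fst (?v ?k)"
    using ik by force
  then have below: "(t ?k - t ?i) / (z ?k - z ?i) * (z r - z ?i) + t ?i \<le> t r" if "r \<le> R" for r
    using line_below_lower_hull[OF _ _ seg, of "z r" "t r"] that by simp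
  have "R > 0"
    using ik by simp
  obtain v where v: "(ahat j \<bullet> x, v) \<in> polygonal_chain R ?v"
    "(t ?k - t ?i) / (z ?k - z ?i) * (ahat j \<bullet> x - z ?i) + t ?i \<le> v"
    by (rule affine_below_polygonal_chain[where w = "ahat j \<bullet> x", OF _ _ \<open>R > 0\<close> below])
      (use w chain in auto)
  have "p + 1 \<le> card (lines_above n (\<Omega> j) (b j) (ahat j \<bullet> x, v))"
    using v(1) chain by blast
  then have "v \<le> - (x \<bullet> a0 j)"
    by (rule feasible_above_point[OF feas assms(10)])
  then show "(t ?k - t ?i) / (z ?k - z ?i) * (ahat j \<bullet> x - z ?i) + t ?i \<le> - (x \<bullet> a0 j)"
    using v(2) by linarith
qed

end
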